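(* Let $a,b,c,d:[t_0,+\infty)\to\mathbb{H}$ be continuous, let $\mathfrak{S}$ be a nonempty subset of $\{0,1,2,3\}$ and let $\mathfrak{O}=\{0,1,2,3\}\setminus\mathfrak{S}$. Let $p_{n,m}(t)$ and $D_n(t)$ be the functions defined in the context. Assume that for all $t\ge t_0$: (i) $a_n(t)\ge 0$ for all $n\in\mathfrak{S}$, and whenever $a_n(t)=0$ for some $n\in\mathfrak{S}$, then $p_{n,m}(t)=0$ for $m=1,2,3$; (ii) $a_n(t)=0$ for all $n\in\mathfrak{O}$; (iii) $D_n(t)\le 0$ for all $n\in\mathfrak{S}$. Then for all real numbers $\gamma_0,\gamma_1,\gamma_2,\gamma_3$ with $\gamma_n\ge 0$ for $n\in\mathfrak{S}$ (and $\gamma_n\in(-\infty,+\infty)$ arbitrary for $n\in\mathfrak{O}$), the quaternionic Riccati equation $$q'+q\,a(t)\,q+b(t)\,q+q\,c(t)+d(t)=0,\qquad t\ge t_0,$$ has a solution $q(t)=q_0(t)-i\,q_1(t)-j\,q_2(t)-k\,q_3(t)$ ($q_0,\dots,q_3$ real valued) on $[t_0,+\infty)$ with $q_n(t_0)=\gamma_n$, $n=0,1,2,3$, and $$q_n(t)\ge 0,\qquad n\in\mathfrak{S},\ t\ge t_0.$$ Moreover, if $\gamma_n>0$ for some $n\in\mathfrak{S}$, then also $q_n(t)>0$ for all $t\ge t_0$ (for that $n$).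
   Context: $\mathbb{H}$ denotes the real quaternions with imaginary units $i,j,k$ satisfying $i^2=j^2=k^2=ijk=-1$, $ij=-ji=k$. Write $a(t)=a_0(t)+i\,a_1(t)+j\,a_2(t)+k\,a_3(t)$ with $a_n$ real valued, and similarly $b(t)=b_0+ib_1+jb_2+kb_3$, $c(t)=c_0+ic_1+jc_2+kc_3$, $d(t)=d_0+id_1+jd_2+kd_3$; all component functions are continuous real valued functions on $[t_0,+\infty)$. A solution of the Riccati equation is a continuously differentiable quaternion-valued function satisfying it. For $t\ge t_0$ put - $p_{0,m}(t)=b_m(t)+c_m(t)$, $m=1,2,3$; - $p_{1,1}(t)=b_1(t)+c_1(t)$, $p_{1,2}(t)=b_2(t)-c_2(t)$, $p_{1,3}(t)=b_3(t)-c_3(t)$; - $p_{2,1}(t)=b_1(t)-c_1(t)$, $p_{2,2}(t)=b_2(t)+c_2(t)$, $p_{2,3}(t)=b_3(t)-c_3(t)$; - $p_{3,1}(t)=b_1(t)-c_1(t)$, $p_{3,2}(t)=b_2(t)-c_2(t)$, $p_{3,3}(t)=b_3(t)+c_3(t)$. Define $$D_0(t)=\begin{cases}\sum_{m=1}^3 p_{0,m}^2(t)+4a_0(t)d_0(t), & a_0(t)\ne 0,\\ 4d_0(t), & a_0(t)=0,\end{cases}$$ and for $n=1,2,3$ $$D_n(t)=\begin{cases}\sum_{m=1}^3 p_{n,m}^2(t)-4a_n(t)d_n(t), & a_n(t)\ne 0,\\ -4d_n(t), & a_n(t)=0.\end{cases}$$ *)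

theory Defs
  imports "HOL-Analysis.Analysis"
begin

section \<open>The real quaternions\<close>

text \<open>The quaternion \<open>Quat w x y z\<close> is \<open>w + i x + j y + k z\<close>; it carries the Hamilton product and
  the Euclidean norm and topology.\<close>

datatype quat = Quat (qre: real) (qim1: real) (qim2: real) (qim3: real)

lemma quat_eq_iff:
  "p = q \<longleftrightarrow> qre p = qre q \<and> qim1 p = qim1 q \<and> qim2 p = qim2 q \<and> qim3 p = qim3 q"
  by (cases p; cases q) simp

instantiation quat :: real_algebra_1
begin

definition "0 = Quat 0 0 0 0"
definition "1 = Quat 1 0 0 0"
definition "p + q = Quat (qre p + qre q) (qim1 p + qim1 q) (qim2 p + qim2 q) (qim3 p + qim3 q)"
definition "p - q = Quat (qre p - qre q) (qim1 p - qim1 q) (qim2 p - qim2 q) (qim3 p - qim3 q)"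
definition "- q = Quat (- qre q) (- qim1 q) (- qim2 q) (- qim3 q)"
definition "r *\<^sub>R q = Quat (r * qre q) (r * qim1 q) (r * qim2 q) (r * qim3 q)"
definition "p * q = Quat
  (qre p * qre q - qim1 p * qim1 q - qim2 p * qim2 q - qim3 p * qim3 q)
  (qre p * qim1 q + qim1 p * qre q + qim2 p * qim3 q - qim3 p * qim2 q)
  (qre p * qim2 q - qim1 p * qim3 q + qim2 p * qre q + qim3 p * qim1 q)
  (qre p * qim3 q + qim1 p * qim2 q - qim2 p * qim1 q + qim3 p * qre q)"

lemmas quat_arith_defs = zero_quat_def one_quat_def plus_quat_def minus_quat_def
  uminus_quat_def scaleR_quat_def times_quat_def

instance
  by standard (simp_all add: quat_eq_iff quat_arith_defs algebra_simps)

end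

instantiation quat :: real_inner
begin

definition "inner p q = qre p * qre q + qim1 p * qim1 q + qim2 p * qim2 q + qim3 p * qim3 q"
definition "norm (q::quat) = sqrt (inner q q)"
definition "dist (p::quat) q = norm (p - q)"
definition "sgn (q::quat) = q /\<^sub>R norm q"
definition "uniformity = (INF e\<in>{0<..}. principal {(p::quat, q). dist p q < e})"
definition "open (U::quat set) \<longleftrightarrow>
  (\<forall>p\<in>U. eventually (\<lambda>(p', q). p' = p \<longrightarrow> q \<in> U) uniformity)"

instance
proof
  fix p :: quat
  show "0 \<le> inner p p"
    by (simp add: inner_quat_def)
  have "w * w + x * x + y * y + z * z = 0 \<longleftrightarrow> w = 0 \<and> x = 0 \<and> y = 0 \<and> z = 0"
    for w x y z :: real
    by (smt (verit) mult_eq_0_iff zero_le_square)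
  then show "inner p p = 0 \<longleftrightarrow> p = 0"
    by (simp add: inner_quat_def quat_eq_iff zero_quat_def)
qed (simp_all add: norm_quat_def dist_quat_def sgn_quat_def uniformity_quat_def open_quat_def
    inner_quat_def quat_arith_defs algebra_simps)

end

lemma norm_mult_quat: "norm (p * q) = norm p * norm (q::quat)"
  unfolding norm_quat_def inner_quat_def real_sqrt_mult [symmetric] times_quat_def quat.sel
  by (rule arg_cong [of _ _ sqrt], algebra)

instance quat :: real_normed_algebra_1
proof
  show "norm (p * q) \<le> norm p * norm q" for p q :: quat
    by (simp add: norm_mult_quat)
  show "norm (1::quat) = 1"
    by (simp add: norm_quat_def inner_quat_def one_quat_def)
qed

definition quat_i :: quat where "quat_i = Quat 0 1 0 0"
definition quat_j :: quat where "quat_j = Quat 0 0 1 0"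
definition quat_k :: quat where "quat_k = Quat 0 0 0 1"

lemma quat_unit_relations:
  "quat_i * quat_i = -1" "quat_j * quat_j = -1" "quat_k * quat_k = -1"
  "quat_i * quat_j * quat_k = -1" "quat_i * quat_j = quat_k" "quat_j * quat_i = - quat_k"
  by (simp_all add: quat_i_def quat_j_def quat_k_def quat_arith_defs)

lemma quat_of_components:
  "of_real w + quat_i * of_real x + quat_j * of_real y + quat_k * of_real z = Quat w x y z"
  by (simp add: of_real_def quat_i_def quat_j_def quat_k_def quat_arith_defs)

text \<open>\<open>qcomp n q\<close> is the coefficient \<open>q\<^sub>n\<close> in \<open>q = q\<^sub>0 + i q\<^sub>1 + j q\<^sub>2 + k q\<^sub>3\<close>; only \<open>n \<le> 3\<close>
  is meaningful.\<close>

definition qcomp :: "nat \<Rightarrow> quat \<Rightarrow> real" where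
  "qcomp n q = (if n = 0 then qre q else if n = 1 then qim1 q else if n = 2 then qim2 q else qim3 q)"


section \<open>The quaternionic Riccati equation\<close>

text \<open>The derivative is taken within \<open>{t0..}\<close>, hence is one-sided at \<open>t0\<close>.\<close>

definition riccati_solution ::
  "(real \<Rightarrow> quat) \<Rightarrow> (real \<Rightarrow> quat) \<Rightarrow> (real \<Rightarrow> quat) \<Rightarrow> (real \<Rightarrow> quat) \<Rightarrow> real \<Rightarrow> (real \<Rightarrow> quat) \<Rightarrow> bool"
where
  "riccati_solution a b c d t0 q \<longleftrightarrow>
    (\<exists>q'. continuous_on {t0..} q' \<and>
      (\<forall>t\<ge>t0. (q has_vector_derivative q' t) (at t within {t0..}) \<and>
              q' t + q t * a t * q t + b t * q t + q t * c t + d t = 0))"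

text \<open>The twelve functions \<open>p\<^sub>n\<^sub>,\<^sub>m\<close> (\<open>n \<le> 3\<close>, \<open>1 \<le> m \<le> 3\<close>): the sign of \<open>c\<^sub>m\<close> is \<open>+\<close> for
  \<open>n = 0\<close> and on the diagonal \<open>n = m\<close>, and \<open>-\<close> otherwise.\<close>

definition riccati_p ::
  "nat \<Rightarrow> nat \<Rightarrow> (real \<Rightarrow> quat) \<Rightarrow> (real \<Rightarrow> quat) \<Rightarrow> real \<Rightarrow> real" where
  "riccati_p n m b c t =
    (if n = 0 \<or> n = m then qcomp m (b t) + qcomp m (c t) else qcomp m (b t) - qcomp m (c t))"

definition riccati_D ::
  "nat \<Rightarrow> (real \<Rightarrow> quat) \<Rightarrow> (real \<Rightarrow> quat) \<Rightarrow> (real \<Rightarrow> quat) \<Rightarrow> (real \<Rightarrow> quat) \<Rightarrow> real \<Rightarrow> real" where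
  "riccati_D n a b c d t =
    (if n = 0 then
       (if qcomp 0 (a t) \<noteq> 0
        then (\<Sum>m=1..3. (riccati_p 0 m b c t)\<^sup>2) + 4 * qcomp 0 (a t) * qcomp 0 (d t)
        else 4 * qcomp 0 (d t))
     else
       (if qcomp n (a t) \<noteq> 0
        then (\<Sum>m=1..3. (riccati_p n m b c t)\<^sup>2) - 4 * qcomp n (a t) * qcomp n (d t)
        else - 4 * qcomp n (d t)))"

end

theory Submission
  imports Defs
begin

text \<open>
  Write \<open>q = q\<^sub>0 - i q\<^sub>1 - j q\<^sub>2 - k q\<^sub>3\<close>. Two identities carry the proof.

  Invariance of the half-spaces \<open>q\<^sub>n \<ge> 0\<close>. The identity
  \<open>q a q = 2 Re(a q) q - \<bar>q\<bar>\<^sup>2 a*\<close> (with \<open>a*\<close> the conjugate) shows that the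
  equation for \<open>q\<^sub>n\<close> is \<open>q\<^sub>n' = N\<^sub>n + g\<^sub>n q\<^sub>n\<close>, where
  \<open>g\<^sub>n = a\<^sub>n q\<^sub>n - 2 Re(a q) - b\<^sub>0 - c\<^sub>0\<close> and \<open>N\<^sub>n\<close> is a quadratic polynomial in the
  other three components: its leading part is \<open>a\<^sub>n\<close> times the sum of their squares, its linear
  coefficients are the \<open>p\<^sub>n\<^sub>,\<^sub>m\<close> up to sign and order, and its constant term is
  \<open>- d\<^sub>0\<close> or \<open>d\<^sub>n\<close>. If \<open>a\<^sub>n > 0\<close>, then \<open>D\<^sub>n \<le> 0\<close> is precisely the
  discriminant condition for \<open>N\<^sub>n \<ge> 0\<close> at all values of the other components; if \<open>a\<^sub>n = 0\<close>,
  then \<open>N\<^sub>n\<close> reduces to its constant term, whose sign is what \<open>D\<^sub>n \<le> 0\<close> prescribes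
  (\<open>riccati_field_quasi_positive\<close>). Hence \<open>q\<^sub>n\<close> divided by \<open>exp (\<integral> g\<^sub>n)\<close> is
  nondecreasing, which preserves both \<open>q\<^sub>n \<ge> 0\<close> and \<open>q\<^sub>n > 0\<close>.

  No blow-up. Since \<open>\<langle>q, q a q\<rangle> = \<bar>q\<bar>\<^sup>2 Re(a q)\<close> and
  \<open>Re(a q) = \<Sum> a\<^sub>n q\<^sub>n\<close> is nonnegative once the components with \<open>a\<^sub>n \<noteq> 0\<close> are, the
  quadratic term can only decrease \<open>\<bar>q\<bar>\<close> (\<open>riccati_field_energy_bound\<close>), and \<open>\<bar>q\<bar>\<close>
  obeys the Gronwall bound of the linear terms.

  To have a solution to which these arguments apply on all of \<open>[t0, \<infinity>)\<close> at once, the vector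
  field is evaluated at the radial truncation of \<open>q\<close> to the ball whose radius \<open>R(t)\<close> is that
  Gronwall bound. The truncated field is Lipschitz with a constant continuous in \<open>t\<close>, so
  \<open>picard_half_line\<close> gives a global solution. Truncation multiplies every component by the same
  factor in \<open>(0, 1]\<close>, so both arguments survive it; they show that the solution stays in the
  ball, where the truncation is the identity.
\<close>

section \<open>Ordinary differential equations on a half-line\<close>

lemma integral_half_line_has_vector_derivative:
  fixes f :: "real \<Rightarrow> 'a::banach"
  assumes "continuous_on {t0..} f" and "t0 \<le> t"
  shows "((\<lambda>t. integral {t0..t} f) has_vector_derivative f t) (at t within {t0..})"
proof -
  have "((\<lambda>t. integral {t0..t} f) has_vector_derivative f t) (at t within {t0..t + 1})"
    using assms by (intro integral_has_vector_derivative continuous_on_subset[OF assms(1)]) auto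
  moreover have "at t within {t0..t + 1} = at t within {t0..}"
    by (rule at_within_nhd[of _ "{..<t + 1}"]) auto
  ultimately show ?thesis by simp
qed

lemma continuous_on_integral_half_line:
  fixes f :: "real \<Rightarrow> 'a::banach"
  assumes "continuous_on {t0..} f"
  shows "continuous_on {t0..} (\<lambda>t. integral {t0..t} f)"
  using integral_half_line_has_vector_derivative[OF assms]
  by (intro continuous_on_vector_derivative) auto

text \<open>The integrating factor \<open>exp (- \<integral> g)\<close> makes \<open>y\<close> nondecreasing, whatever the signs of
  \<open>y\<close> and \<open>g\<close>. For a component of a solution this is a positivity statement; for the negative of
  an energy it is Gronwall's upper bound.\<close>

lemma linear_differential_inequality:
  fixes y y' g :: "real \<Rightarrow> real"
  assumes g: "continuous_on {t0..} g"
    and der: "\<And>t. t0 \<le> t \<Longrightarrow> (y has_vector_derivative y' t) (at t within {t0..})"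
    and le: "\<And>t. t0 \<le> t \<Longrightarrow> g t * y t \<le> y' t"
    and t: "t0 \<le> t"
  shows "y t0 * exp (integral {t0..t} g) \<le> y t"
proof -
  define G where "G t = integral {t0..t} g" for t
  define z where "z t = y t * exp (- G t)" for t
  have G: "(G has_vector_derivative g s) (at s within {t0..})" if "t0 \<le> s" for s
    unfolding G_def using g that by (rule integral_half_line_has_vector_derivative)
  have z: "(z has_derivative (*) ((y' s - g s * y s) * exp (- G s))) (at s within {t0..t})"
    if "t0 \<le> s" for s
  proof -
    have "(z has_real_derivative (y' s - g s * y s) * exp (- G s)) (at s within {t0..})"
      unfolding z_def using der[OF that] G[OF that]
      unfolding has_real_derivative_iff_has_vector_derivative[symmetric]
      by (auto intro!: derivative_eq_intros simp: algebra_simps)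
    then show ?thesis
      by (auto simp: has_field_derivative_def intro: has_derivative_subset)
  qed
  obtain s where s: "s \<in> {t0..t}"
    and eq: "z t - z t0 = (y' s - g s * y s) * exp (- G s) * (t - t0)"
    using mvt_very_simple[OF t z] by auto
  have "0 \<le> z t - z t0"
    unfolding eq using le[of s] s t by simp
  then have "y t0 \<le> y t * exp (- G t)"
    by (simp add: z_def G_def)
  then have "y t0 * exp (G t) \<le> y t * exp (- G t) * exp (G t)"
    by (intro mult_right_mono) auto
  then show ?thesis
    by (simp add: G_def mult.assoc flip: exp_add)
qed

text \<open>The weight \<open>exp (2 \<Lambda>)\<close> has derivative \<open>2 K exp (2 \<Lambda>)\<close>, so integrating
  \<open>K exp (2 \<Lambda>)\<close> costs only a factor one half, uniformly in \<open>t\<close>. This half is the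
  contraction constant in the existence theorem below.\<close>

lemma weighted_integral_bound:
  fixes u :: "real \<Rightarrow> 'a::banach" and K :: "real \<Rightarrow> real" and t0 :: real
  defines "\<Lambda> \<equiv> \<lambda>t. integral {t0..t} K"
  assumes K: "continuous_on {t0..} K" and u: "continuous_on {t0..} u"
    and le: "\<And>s. t0 \<le> s \<Longrightarrow> norm (u s) \<le> M * (K s * exp (2 * \<Lambda> s))"
    and M: "0 \<le> M" and t: "t0 \<le> t"
  shows "exp (- 2 * \<Lambda> t) * norm (integral {t0..t} u) \<le> M / 2"
proof -
  have "((\<lambda>s. M / 2 * exp (2 * \<Lambda> s)) has_vector_derivative M * (K s * exp (2 * \<Lambda> s)))
      (at s within {t0..t})" if "s \<in> {t0..t}" for s
  proof -
    have "(\<Lambda> has_vector_derivative K s) (at s within {t0..})"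
      unfolding \<Lambda>_def using that by (intro integral_half_line_has_vector_derivative K) auto
    then have "((\<lambda>s. M / 2 * exp (2 * \<Lambda> s)) has_vector_derivative M * (K s * exp (2 * \<Lambda> s)))
      (at s within {t0..})"
      unfolding has_real_derivative_iff_has_vector_derivative[symmetric]
      by (auto intro!: derivative_eq_intros)
    then show ?thesis by (rule has_vector_derivative_within_subset) auto
  qed
  then have I: "((\<lambda>s. M * (K s * exp (2 * \<Lambda> s))) has_integral
      (M / 2 * exp (2 * \<Lambda> t) - M / 2 * exp (2 * \<Lambda> t0))) {t0..t}"
    using t by (intro fundamental_theorem_of_calculus)
  have "norm (integral {t0..t} u) \<le> integral {t0..t} (\<lambda>s. M * (K s * exp (2 * \<Lambda> s)))"
    using le by (intro integral_norm_bound_integral has_integral_integrable[OF I]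
        integrable_continuous_interval continuous_on_subset[OF u]) auto
  also have "\<dots> = M / 2 * exp (2 * \<Lambda> t) - M / 2 * exp (2 * \<Lambda> t0)"
    using I by (rule integral_unique)
  also have "\<dots> \<le> M / 2 * exp (2 * \<Lambda> t)"
    using M by simp
  finally have "exp (- 2 * \<Lambda> t) * norm (integral {t0..t} u)
      \<le> exp (- 2 * \<Lambda> t) * (M / 2 * exp (2 * \<Lambda> t))"
    by (intro mult_left_mono) auto
  also have "\<dots> = M / 2"
    by (simp add: mult.left_commute flip: exp_add)
  finally show ?thesis .
qed

text \<open>Banach's fixed point theorem, applied to the integral equation written for the rescaled
  unknown \<open>y = exp (- 2 \<Lambda>) (x - x0)\<close> in the space of bounded continuous functions. Because the
  weight grows with the integral of the Lipschitz constant, a single contraction covers the whole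
  half-line.\<close>

theorem picard_half_line:
  fixes F :: "real \<Rightarrow> 'a::banach \<Rightarrow> 'a"
  assumes cont: "\<And>x. continuous_on {t0..} x \<Longrightarrow> continuous_on {t0..} (\<lambda>t. F t (x t))"
    and K: "continuous_on {t0..} K"
    and lip: "\<And>t x y. t0 \<le> t \<Longrightarrow> norm (F t x - F t y) \<le> K t * norm (x - y)"
  shows "\<exists>x. x t0 = x0 \<and>
    (\<forall>t\<ge>t0. (x has_vector_derivative F t (x t)) (at t within {t0..}))"
proof -
  \<comment> \<open>Adding \<open>norm (F t x0)\<close> makes the weight also dominate the inhomogeneity of the integral
    equation, so that the integral operator preserves boundedness.\<close>
  define K1 where "K1 t = \<bar>K t\<bar> + norm (F t x0)" for t
  have K1: "continuous_on {t0..} K1"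
    unfolding K1_def using K cont[of "\<lambda>_. x0"] by (auto intro!: continuous_intros)
  have K1_nonneg: "0 \<le> K1 t" for t
    by (simp add: K1_def)
  have lip1: "norm (F t x - F t y) \<le> K1 t * norm (x - y)" if "t0 \<le> t" for t x y
  proof -
    have "K t \<le> K1 t"
      unfolding K1_def using norm_ge_zero[of "F t x0"] by linarith
    then have "K t * norm (x - y) \<le> K1 t * norm (x - y)"
      by (intro mult_right_mono) auto
    with lip[OF that, of x y] show ?thesis by linarith
  qed
  define \<Lambda> where "\<Lambda> t = integral {t0..t} K1" for t
  have \<Lambda>: "continuous_on {t0..} \<Lambda>"
    unfolding \<Lambda>_def using K1 by (rule continuous_on_integral_half_line)
  have \<Lambda>_nonneg: "0 \<le> \<Lambda> t" if "t0 \<le> t" for t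
    unfolding \<Lambda>_def
    using K1_nonneg by (intro integral_nonneg integrable_continuous_interval
        continuous_on_subset[OF K1]) auto
  define v where "v y t = F t (x0 + exp (2 * \<Lambda> t) *\<^sub>R y t)" for y :: "real \<Rightarrow> 'a" and t
  have v: "continuous_on {t0..} (v y)" if "continuous_on {t0..} y" for y
    unfolding v_def using that \<Lambda> by (intro cont continuous_intros)
  \<comment> \<open>Bounded continuous functions live on all of \<open>\<real>\<close>; \<open>max t0 t\<close> extends the values constantly
    to the left of \<open>t0\<close>.\<close>
  define W where
    "W y t = exp (- 2 * \<Lambda> (max t0 t)) *\<^sub>R integral {t0..max t0 t} (v y)" for y t
  have v_bound: "norm (v y s) \<le> (1 + M) * (K1 s * exp (2 * \<Lambda> s))"
    if "\<And>s. norm (y s) \<le> M" "0 \<le> M" "t0 \<le> s" for y M s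
  proof -
    have "norm (v y s) \<le> norm (F s x0) + norm (v y s - F s x0)"
      by (rule order_trans[OF _ norm_triangle_ineq]) simp
    also have "norm (v y s - F s x0) \<le> K1 s * (exp (2 * \<Lambda> s) * norm (y s))"
      using lip1[OF that(3), of "x0 + exp (2 * \<Lambda> s) *\<^sub>R y s" x0] by (simp add: v_def)
    also have "\<dots> \<le> K1 s * (exp (2 * \<Lambda> s) * M)"
      using that K1_nonneg by (intro mult_left_mono) auto
    also have "norm (F s x0) \<le> K1 s * exp (2 * \<Lambda> s)"
      using mult_mono[of "norm (F s x0)" "K1 s" 1 "exp (2 * \<Lambda> s)"] \<Lambda>_nonneg[OF that(3)]
      by (simp add: K1_def)
    finally show ?thesis by (simp add: algebra_simps)
  qed
  have W: "W (apply_bcontfun y) \<in> bcontfun" for y :: "real \<Rightarrow>\<^sub>C 'a"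
  proof (rule bcontfun_normI)
    show "continuous_on UNIV (W y)"
      unfolding W_def
      by (intro continuous_intros continuous_on_compose2[OF \<Lambda>]
          continuous_on_compose2[OF continuous_on_integral_half_line[OF v]]) auto
    show "norm (W y t) \<le> (1 + norm y) / 2" for t
      using weighted_integral_bound[OF K1 v v_bound[of y "norm y", unfolded \<Lambda>_def], of "max t0 t"]
      by (simp add: W_def norm_bounded \<Lambda>_def)
  qed
  define Tr where "Tr y = Bcontfun (W (apply_bcontfun y))" for y :: "real \<Rightarrow>\<^sub>C 'a"
  have Tr: "apply_bcontfun (Tr y) = W (apply_bcontfun y)" for y
    unfolding Tr_def using W by (rule Bcontfun_inverse)
  have contraction: "dist (Tr y) (Tr z) \<le> 1 / 2 * dist y z" for y z
  proof (rule dist_bound)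
    fix t
    have diff: "norm (v y s - v z s) \<le> norm (y - z) * (K1 s * exp (2 * \<Lambda> s))" if "t0 \<le> s" for s
    proof -
      have "norm (v y s - v z s) \<le> K1 s * norm (exp (2 * \<Lambda> s) *\<^sub>R (y s - z s))"
        using lip1[OF that, of "x0 + exp (2 * \<Lambda> s) *\<^sub>R y s" "x0 + exp (2 * \<Lambda> s) *\<^sub>R z s"]
        by (simp add: v_def scaleR_diff_right)
      also have "\<dots> \<le> K1 s * (exp (2 * \<Lambda> s) * norm (y - z))"
        using K1_nonneg norm_bounded[of "y - z" s] by (auto intro!: mult_left_mono)
      finally show ?thesis by (simp add: mult_ac)
    qed
    have int: "v y integrable_on {t0..max t0 t}" for y :: "real \<Rightarrow>\<^sub>C 'a"
      by (intro integrable_continuous_interval continuous_on_subset[OF v]) auto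
    have "dist (Tr y t) (Tr z t)
        = exp (- 2 * \<Lambda> (max t0 t)) * norm (integral {t0..max t0 t} (\<lambda>s. v y s - v z s))"
      by (simp add: Tr W_def dist_norm integral_diff[OF int int] flip: scaleR_diff_right)
    also have "\<dots> \<le> norm (y - z) / 2"
      unfolding \<Lambda>_def using diff unfolding \<Lambda>_def
      by (intro weighted_integral_bound K1 continuous_on_diff v) auto
    finally show "dist (Tr y t) (Tr z t) \<le> 1 / 2 * dist y z"
      by (simp add: dist_norm)
  qed
  obtain y where y: "Tr y = y"
    using banach_fix_type[of "1/2" Tr] contraction by auto
  define x where "x t = x0 + integral {t0..t} (v y)" for t
  have x_eq: "x t = x0 + exp (2 * \<Lambda> t) *\<^sub>R y t" if "t0 \<le> t" for t
  proof -
    have "y t = exp (- 2 * \<Lambda> t) *\<^sub>R integral {t0..t} (v y)"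
      using fun_cong[OF Tr[of y], of t] that by (simp add: y W_def max_def)
    then have "exp (2 * \<Lambda> t) *\<^sub>R y t = integral {t0..t} (v y)"
      by (simp flip: exp_add)
    then show ?thesis by (simp add: x_def)
  qed
  have "(x has_vector_derivative F t (x t)) (at t within {t0..})" if "t0 \<le> t" for t
  proof -
    have "(x has_vector_derivative v y t) (at t within {t0..})"
      unfolding x_def using integral_half_line_has_vector_derivative[OF v that]
      by (auto intro!: derivative_eq_intros)
    then show ?thesis by (simp add: v_def x_eq[OF that])
  qed
  moreover have "x t0 = x0"
    by (simp add: x_def)
  ultimately show ?thesis by blast
qed

section \<open>Radial truncation\<close>

text \<open>The map \<open>x \<mapsto> radial_factor R x *\<^sub>R x\<close> is the radial retraction onto the closed ball of
  radius \<open>R\<close>. The scalar factor is named, rather than the retraction, because the invariance and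
  energy arguments use that all components are scaled alike.\<close>

definition radial_factor :: "real \<Rightarrow> 'a::real_normed_vector \<Rightarrow> real" where
  "radial_factor R x = R / max R (norm x)"

lemma radial_factor_pos: "0 < R \<Longrightarrow> 0 < radial_factor R x"
  by (auto simp: radial_factor_def less_max_iff_disj)

lemma radial_factor_le_1: "0 < R \<Longrightarrow> radial_factor R x \<le> 1"
  by (auto simp: radial_factor_def divide_simps)

lemma radial_factor_eq_1: "0 < R \<Longrightarrow> norm x \<le> R \<Longrightarrow> radial_factor R x = 1"
  by (simp add: radial_factor_def)

lemma norm_radial_truncation_le:
  fixes x :: "'a::real_normed_vector"
  assumes "0 < R"
  shows "norm (radial_factor R x *\<^sub>R x) \<le> R"
proof -
  have "R * norm x \<le> R * max R (norm x)"
    using assms by (intro mult_left_mono) auto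
  then show ?thesis
    using assms by (simp add: radial_factor_def divide_simps less_max_iff_disj)
qed

text \<open>With \<open>X\<close> and \<open>Y\<close> the two denominators, the difference splits as
  \<open>(R/X) (x - y) + (R/X - R/Y) y\<close>; each part is at most \<open>norm (x - y)\<close>.\<close>

lemma radial_truncation_lipschitz:
  fixes x y :: "'a::real_normed_vector"
  assumes R: "0 < R"
  shows "norm (radial_factor R x *\<^sub>R x - radial_factor R y *\<^sub>R y) \<le> 2 * norm (x - y)"
proof -
  define X Y where "X = max R (norm x)" and "Y = max R (norm y)"
  have pos: "0 < X" "0 < Y" "R \<le> X" "R \<le> Y" "norm y \<le> Y"
    using R by (auto simp: X_def Y_def)
  have "\<bar>Y - X\<bar> \<le> norm (x - y)"
    unfolding X_def Y_def using norm_triangle_ineq3[of x y] by linarith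
  moreover have "\<bar>R / X - R / Y\<bar> * norm y = \<bar>Y - X\<bar> * ((R / X) * (norm y / Y))"
  proof -
    have "R / X - R / Y = (Y - X) * (R / (X * Y))"
      using pos by (simp add: field_simps)
    then show ?thesis using pos R by (simp add: abs_mult)
  qed
  moreover have "(R / X) * (norm y / Y) \<le> 1 * 1"
    using pos R by (intro mult_mono) auto
  then have "\<bar>Y - X\<bar> * ((R / X) * (norm y / Y)) \<le> \<bar>Y - X\<bar> * 1"
    by (intro mult_left_mono) auto
  ultimately have 1: "\<bar>R / X - R / Y\<bar> * norm y \<le> norm (x - y)"
    by simp
  have "R / X * norm (x - y) \<le> 1 * norm (x - y)"
    using pos R by (intro mult_right_mono) auto
  moreover have "(R / X) *\<^sub>R x - (R / Y) *\<^sub>R y = (R / X) *\<^sub>R (x - y) + (R / X - R / Y) *\<^sub>R y"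
    by (simp add: algebra_simps)
  then have "norm ((R / X) *\<^sub>R x - (R / Y) *\<^sub>R y) \<le> R / X * norm (x - y) + \<bar>R / X - R / Y\<bar> * norm y"
    using norm_triangle_ineq[of "(R / X) *\<^sub>R (x - y)" "(R / X - R / Y) *\<^sub>R y"] pos R by simp
  ultimately show ?thesis
    using 1 unfolding radial_factor_def X_def[symmetric] Y_def[symmetric] by linarith
qed

lemma continuous_on_radial_factor:
  assumes "continuous_on A R" "continuous_on A x" "\<And>t. t \<in> A \<Longrightarrow> 0 < R t"
  shows "continuous_on A (\<lambda>t. radial_factor (R t) (x t))"
proof -
  have "max (R t) (norm (x t)) \<noteq> 0" if "t \<in> A" for t
    using assms(3)[OF that] by (metis less_irrefl less_max_iff_disj)
  then show ?thesis
    unfolding radial_factor_def using assms by (intro continuous_intros) auto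
qed

section \<open>Positivity and growth of the Riccati vector field\<close>

text \<open>Finite dimension makes the quaternions complete, as the existence theorem requires.\<close>

instantiation quat :: euclidean_space
begin

definition "Basis = {1, quat_i, quat_j, quat_k}"

instance
proof
  note unit_defs = one_quat_def quat_i_def quat_j_def quat_k_def inner_quat_def
  show "(Basis :: quat set) \<noteq> {}" and "finite (Basis :: quat set)"
    unfolding Basis_quat_def by (rule insert_not_empty, intro finite.intros)
  show "inner u v = (if u = v then 1 else 0)" if "u \<in> Basis" and "v \<in> Basis" for u v :: quat
    using that unfolding Basis_quat_def insert_iff empty_iff simp_thms
    by (elim disjE) (simp_all only: unit_defs quat.sel quat.inject, simp_all)
  show "(\<forall>u\<in>Basis. inner x u = 0) \<longleftrightarrow> x = 0" for x :: quat
    unfolding Basis_quat_def by (cases x) (simp add: unit_defs zero_quat_def)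
qed

end

text \<open>These are the real coordinates \<open>q\<^sub>n\<close> of the representation
  \<open>q = q\<^sub>0 - i q\<^sub>1 - j q\<^sub>2 - k q\<^sub>3\<close>.\<close>

definition signed_comp :: "nat \<Rightarrow> quat \<Rightarrow> real" where
  "signed_comp n q = (if n = 0 then qre q else - qcomp n q)"

lemma bounded_linear_qre: "bounded_linear qre"
proof -
  have "qre = (\<lambda>q. inner q 1)" by (auto simp: inner_quat_def one_quat_def)
  then show ?thesis
    using bounded_linear_inner_left[of "1::quat"] by metis
qed

lemma bounded_linear_signed_comp: "bounded_linear (signed_comp n)"
proof -
  have "signed_comp n = (\<lambda>q. inner q (if n = 0 then 1 else if n = 1 then - quat_i
      else if n = 2 then - quat_j else - quat_k))"
    by (auto simp: fun_eq_iff signed_comp_def qcomp_def inner_quat_def one_quat_def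
        quat_i_def quat_j_def quat_k_def uminus_quat_def)
  then show ?thesis
    using bounded_linear_inner_left by metis
qed

lemma quat_of_signed_comps:
  "of_real (signed_comp 0 q) - quat_i * of_real (signed_comp 1 q)
     - quat_j * of_real (signed_comp 2 q) - quat_k * of_real (signed_comp 3 q) = q"
  by (cases q) (simp add: signed_comp_def qcomp_def of_real_def quat_i_def quat_j_def quat_k_def
      quat_arith_defs)

definition riccati_field :: "quat \<Rightarrow> quat \<Rightarrow> quat \<Rightarrow> quat \<Rightarrow> quat \<Rightarrow> quat" where
  "riccati_field a b c d q = - (q * a * q + b * q + q * c + d)"

text \<open>For \<open>\<alpha> > 0\<close>, complete the squares after multiplying by \<open>4 \<alpha>\<close>.\<close>

lemma definite_quadratic_nonneg:
  fixes \<alpha> \<delta> u v w x y z :: real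
  assumes "0 \<le> \<alpha>" and "\<alpha> = 0 \<Longrightarrow> u = 0 \<and> v = 0 \<and> w = 0 \<and> 0 \<le> \<delta>"
    and "\<alpha> \<noteq> 0 \<Longrightarrow> u\<^sup>2 + v\<^sup>2 + w\<^sup>2 \<le> 4 * \<alpha> * \<delta>"
  shows "0 \<le> \<alpha> * (x\<^sup>2 + y\<^sup>2 + z\<^sup>2) + u * x + v * y + w * z + \<delta>"
proof (cases "\<alpha> = 0")
  case False
  have "0 \<le> (2 * \<alpha> * x + u)\<^sup>2 + (2 * \<alpha> * y + v)\<^sup>2 + (2 * \<alpha> * z + w)\<^sup>2
      + (4 * \<alpha> * \<delta> - (u\<^sup>2 + v\<^sup>2 + w\<^sup>2))"
    using assms(3)[OF False] by auto
  also have "\<dots> = 4 * \<alpha> * (\<alpha> * (x\<^sup>2 + y\<^sup>2 + z\<^sup>2) + u * x + v * y + w * z + \<delta>)"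
    by algebra
  finally show ?thesis
    using False assms(1) by (simp add: zero_le_mult_iff)
qed (use assms(2) in simp)

text \<open>The difference of the two sides is the polynomial \<open>N\<^sub>n\<close> in the other three components.
  Its linear coefficients are the \<open>p\<^sub>n\<^sub>,\<^sub>m\<close> with signs and an order that depend on \<open>n\<close>, which
  the discriminant does not see; the four cases only differ in this matching.\<close>

lemma riccati_field_quasi_positive:
  assumes n: "n \<in> {0, 1, 2, 3}"
    and a: "0 \<le> qcomp n (a t)"
    and p: "\<And>m. qcomp n (a t) = 0 \<Longrightarrow> m \<in> {1, 2, 3} \<Longrightarrow> riccati_p n m b c t = 0"
    and D: "riccati_D n a b c d t \<le> 0"
  shows "(qcomp n (a t) * signed_comp n q - 2 * qre (a t * q) - qre (b t) - qre (c t))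
      * signed_comp n q
    \<le> signed_comp n (riccati_field (a t) (b t) (c t) (d t) q)"
proof -
  let ?p = "\<lambda>m. riccati_p n m b c t"
  \<comment> \<open>Atoms for the coefficient values keep the polynomial identities below small.\<close>
  define A B C E where defs: "A = a t" "B = b t" "C = c t" "E = d t"
  have sum_p: "(\<Sum>m=1..3. (riccati_p k m b c t)\<^sup>2)
      = (riccati_p k 1 b c t)\<^sup>2 + (riccati_p k 2 b c t)\<^sup>2 + (riccati_p k 3 b c t)\<^sup>2" for k
    by (simp add: eval_nat_numeral)
  have N_nonneg: "0 \<le> qcomp n (a t) * (x\<^sup>2 + y\<^sup>2 + z\<^sup>2) + u * x + v * y + w * z
      + (if n = 0 then - 1 else 1) * qcomp n (d t)"
    if "u\<^sup>2 = (?p 1)\<^sup>2" "v\<^sup>2 = (?p 2)\<^sup>2" "w\<^sup>2 = (?p 3)\<^sup>2" for u v w x y z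
    using a p[of 1] p[of 2] p[of 3] D that
    by (intro definite_quadratic_nonneg)
      (auto simp: riccati_D_def sum_p[unfolded One_nat_def] split: if_splits)
  have via_quadratic: "l \<le> r"
    if "r - l = qcomp n (a t) * (x\<^sup>2 + y\<^sup>2 + z\<^sup>2) + u * x + v * y + w * z
        + (if n = 0 then - 1 else 1) * qcomp n (d t)"
      and "u\<^sup>2 = (?p 1)\<^sup>2" "v\<^sup>2 = (?p 2)\<^sup>2" "w\<^sup>2 = (?p 3)\<^sup>2" for l r u v w x y z
    using N_nonneg[OF that(2-4), of x y z] unfolding that(1)[symmetric] by simp
  note expand = riccati_p_def riccati_field_def signed_comp_def qcomp_def defs[symmetric]
    times_quat_def plus_quat_def uminus_quat_def quat.sel
  consider "n = 0" | "n = 1" | "n = 2" | "n = 3" using n by auto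
  then show ?thesis
  proof cases
    case 1
    show ?thesis unfolding 1
      by (rule via_quadratic[unfolded 1, of _ _ "signed_comp 1 q" "signed_comp 2 q" "signed_comp 3 q"
            "- riccati_p 0 1 b c t" "- riccati_p 0 2 b c t" "- riccati_p 0 3 b c t"])
        (simp_all add: expand, algebra+)
  next
    case 2
    show ?thesis unfolding 2
      by (rule via_quadratic[unfolded 2, of _ _ "signed_comp 0 q" "signed_comp 3 q" "signed_comp 2 q"
            "riccati_p 1 1 b c t" "- riccati_p 1 2 b c t" "riccati_p 1 3 b c t"])
        (simp_all add: expand, algebra+)
  next
    case 3
    show ?thesis unfolding 3
      by (rule via_quadratic[unfolded 3, of _ _ "signed_comp 3 q" "signed_comp 0 q" "signed_comp 1 q"
            "riccati_p 2 1 b c t" "riccati_p 2 2 b c t" "- riccati_p 2 3 b c t"])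
        (simp_all add: expand, algebra+)
  next
    case 4
    show ?thesis unfolding 4
      by (rule via_quadratic[unfolded 4, of _ _ "signed_comp 2 q" "signed_comp 1 q" "signed_comp 0 q"
            "- riccati_p 3 1 b c t" "riccati_p 3 2 b c t" "riccati_p 3 3 b c t"])
        (simp_all add: expand, algebra+)
  qed
qed

lemma inner_quadratic_term: "inner q (q * a * q) = (norm q)\<^sup>2 * qre (a * q)"
  unfolding dot_square_norm[symmetric]
  by (simp add: inner_quat_def times_quat_def algebra_simps)

text \<open>The minus signs in \<open>q = q\<^sub>0 - i q\<^sub>1 - j q\<^sub>2 - k q\<^sub>3\<close> cancel those of \<open>i\<^sup>2 = j\<^sup>2 = k\<^sup>2 = - 1\<close>.
  So nonnegative coordinates make \<open>Re(a q)\<close> nonnegative, and with it the damping in the energy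
  estimate.\<close>

lemma qre_mult_eq_sum_signed_comps:
  "qre (a * q) = (\<Sum>n\<in>{0, 1, 2, 3}. qcomp n a * signed_comp n q)"
  by (simp add: times_quat_def qcomp_def signed_comp_def)

text \<open>The quadratic term is handled by \<open>p a p - q a q = p a (p - q) + (p - q) a q\<close>.\<close>

lemma riccati_field_lipschitz:
  assumes "norm p \<le> R" "norm q \<le> R"
  shows "norm (riccati_field a b c d p - riccati_field a b c d q)
    \<le> (2 * R * norm a + norm b + norm c) * norm (p - q)"
proof -
  let ?e = "norm (p - q)"
  have triangle: "norm (- x - y - z - w) \<le> norm x + norm y + norm z + norm w"
    for x y z w :: quat
    using norm_triangle_ineq4[of "- x - y - z" w] norm_triangle_ineq4[of "- x - y" z]
      norm_triangle_ineq4[of "- x" y] norm_minus_cancel[of x]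
    by linarith
  have "riccati_field a b c d p - riccati_field a b c d q
      = - (p * a * (p - q)) - (p - q) * a * q - b * (p - q) - (p - q) * c"
    by (simp add: riccati_field_def algebra_simps)
  then have "norm (riccati_field a b c d p - riccati_field a b c d q)
      \<le> norm (p * a * (p - q)) + norm ((p - q) * a * q) + norm (b * (p - q)) + norm ((p - q) * c)"
    by (simp only: triangle)
  also have "\<dots> = (norm p * norm a + norm a * norm q + norm b + norm c) * ?e"
    unfolding norm_mult_quat by (simp add: algebra_simps)
  also have "\<dots> \<le> (R * norm a + norm a * R + norm b + norm c) * ?e"
    using assms by (intro mult_right_mono add_mono mult_left_mono order_refl) auto
  finally show ?thesis by (simp add: algebra_simps)
qed

text \<open>The quadratic term contributes \<open>- r\<^sup>2 \<bar>q\<bar>\<^sup>2 Re(a q) \<le> 0\<close> and can be dropped; what is left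
  grows at most linearly in \<open>1 + \<bar>q\<bar>\<^sup>2\<close>. The scalar \<open>r\<close> stands for the truncation factor.\<close>

lemma riccati_field_energy_bound:
  assumes aq: "0 \<le> qre (a * q)" and r: "0 \<le> r" "r \<le> 1"
  shows "inner q (riccati_field a b c d (r *\<^sub>R q))
    \<le> (norm b + norm c + norm d) * (1 + (norm q)\<^sup>2)"
proof -
  let ?N = "1 + (norm q)\<^sup>2"
  have "inner q (riccati_field a b c d (r *\<^sub>R q))
      = - r\<^sup>2 * ((norm q)\<^sup>2 * qre (a * q)) - r * inner q (b * q) - r * inner q (q * c) - inner q d"
    by (simp add: riccati_field_def inner_add_right inner_diff_right inner_quadratic_term
        power2_eq_square)
  moreover have "0 \<le> r\<^sup>2 * ((norm q)\<^sup>2 * qre (a * q))"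
    using aq by simp
  moreover have lin: "- r * inner q p \<le> norm e * ?N" if "norm p = norm e * norm q" for p e :: quat
  proof -
    have "- r * inner q p \<le> r * \<bar>inner q p\<bar>"
      using mult_left_mono[OF abs_ge_minus_self r(1), of "inner q p"] by simp
    also have "\<dots> \<le> 1 * (norm q * norm p)"
      using r by (intro mult_mono Cauchy_Schwarz_ineq2) auto
    also have "\<dots> = norm e * (norm q)\<^sup>2"
      by (simp add: that power2_eq_square)
    also have "\<dots> \<le> norm e * ?N"
      by (intro mult_left_mono) auto
    finally show ?thesis .
  qed
  moreover have "- r * inner q (b * q) \<le> norm b * ?N" "- r * inner q (q * c) \<le> norm c * ?N"
    by (rule lin; simp add: norm_mult_quat mult.commute)+
  moreover have "- inner q d \<le> norm d * ?N"
  proof -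
    have "norm q \<le> ?N"
      using sum_squares_bound[of 1 "norm q"] norm_ge_zero[of q] by (simp del: norm_ge_zero)
    then have "norm q * norm d \<le> ?N * norm d"
      by (intro mult_right_mono) auto
    then show ?thesis
      using Cauchy_Schwarz_ineq2[of q d] by (simp add: mult.commute)
  qed
  ultimately show ?thesis
    by (simp add: algebra_simps)
qed

lemma continuous_on_riccati_field:
  assumes "continuous_on A a" "continuous_on A b" "continuous_on A c" "continuous_on A d"
    "continuous_on A q"
  shows "continuous_on A (\<lambda>t. riccati_field (a t) (b t) (c t) (d t) (q t))"
  unfolding riccati_field_def by (intro continuous_intros assms)

section \<open>Global nonnegative solutions\<close>

lemma truncated_riccati_solution:
  assumes cont: "continuous_on {t0..} a" "continuous_on {t0..} b"
    "continuous_on {t0..} c" "continuous_on {t0..} d"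
    and R: "continuous_on {t0..} R" "\<And>t. t0 \<le> t \<Longrightarrow> 0 < R t"
  shows "\<exists>x. x t0 = x0 \<and> (\<forall>t\<ge>t0. (x has_vector_derivative
    riccati_field (a t) (b t) (c t) (d t) (radial_factor (R t) (x t) *\<^sub>R x t)) (at t within {t0..}))"
proof (rule picard_half_line)
  fix x :: "real \<Rightarrow> quat"
  assume "continuous_on {t0..} x"
  then show "continuous_on {t0..} (\<lambda>t. riccati_field (a t) (b t) (c t) (d t)
      (radial_factor (R t) (x t) *\<^sub>R x t))"
    using R by (intro continuous_on_riccati_field cont continuous_on_scaleR
        continuous_on_radial_factor) auto
next
  show "continuous_on {t0..} (\<lambda>t. (2 * R t * norm (a t) + norm (b t) + norm (c t)) * 2)"
    by (intro continuous_intros cont R)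
next
  fix t x y
  assume t: "t0 \<le> t"
  let ?L = "2 * R t * norm (a t) + norm (b t) + norm (c t)"
  let ?r = "\<lambda>x::quat. radial_factor (R t) x *\<^sub>R x"
  let ?f = "riccati_field (a t) (b t) (c t) (d t)"
  have "norm (?f (?r x) - ?f (?r y)) \<le> ?L * norm (?r x - ?r y)"
    using R(2)[OF t] by (intro riccati_field_lipschitz norm_radial_truncation_le)
  also have "\<dots> \<le> ?L * (2 * norm (x - y))"
    using R(2)[OF t] by (intro mult_left_mono radial_truncation_lipschitz) auto
  finally show "norm (?f (?r x) - ?f (?r y)) \<le> ?L * 2 * norm (x - y)"
    by (simp only: mult.assoc)
qed

theorem theorem3p1:
  fixes a b c d :: "real \<Rightarrow> quat" and t0 :: real and S Oc :: "nat set" and \<gamma> :: "nat \<Rightarrow> real"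
  assumes "continuous_on {t0..} a" and "continuous_on {t0..} b"
    and "continuous_on {t0..} c" and "continuous_on {t0..} d"
    and "S \<noteq> {}" and "S \<subseteq> {0, 1, 2, 3}" and "Oc = {0, 1, 2, 3} - S"
    and "\<And>t n. t \<ge> t0 \<Longrightarrow> n \<in> S \<Longrightarrow> qcomp n (a t) \<ge> 0"
    and "\<And>t n m. t \<ge> t0 \<Longrightarrow> n \<in> S \<Longrightarrow> qcomp n (a t) = 0 \<Longrightarrow> m \<in> {1, 2, 3} \<Longrightarrow> riccati_p n m b c t = 0"
    and "\<And>t n. t \<ge> t0 \<Longrightarrow> n \<in> Oc \<Longrightarrow> qcomp n (a t) = 0"
    and "\<And>t n. t \<ge> t0 \<Longrightarrow> n \<in> S \<Longrightarrow> riccati_D n a b c d t \<le> 0"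
    and "\<And>n. n \<in> S \<Longrightarrow> \<gamma> n \<ge> 0"
  shows "\<exists>q :: nat \<Rightarrow> real \<Rightarrow> real.
    riccati_solution a b c d t0
      (\<lambda>t. of_real (q 0 t) - quat_i * of_real (q 1 t) - quat_j * of_real (q 2 t)
             - quat_k * of_real (q 3 t)) \<and>
    (\<forall>n\<in>{0, 1, 2, 3}. q n t0 = \<gamma> n) \<and>
    (\<forall>n\<in>S. \<forall>t\<ge>t0. q n t \<ge> 0) \<and>
    (\<forall>n\<in>S. \<gamma> n > 0 \<longrightarrow> (\<forall>t\<ge>t0. q n t > 0))"
proof -
  note cont = assms(1-4) and S = assms(6,7) and a_nonneg = assms(8) and p_zero = assms(9)
    and a_zero = assms(10) and D_nonpos = assms(11) and \<gamma>_nonneg = assms(12)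
  define x0 where "x0 = of_real (\<gamma> 0) - quat_i * of_real (\<gamma> 1) - quat_j * of_real (\<gamma> 2)
      - quat_k * of_real (\<gamma> 3)"
  have x0: "signed_comp n x0 = \<gamma> n" if "n \<in> {0, 1, 2, 3}" for n
    using that by (auto simp: x0_def signed_comp_def qcomp_def of_real_def quat_i_def quat_j_def
        quat_k_def quat_arith_defs)
  \<comment> \<open>\<open>R\<close> is the bound that the energy inequality \<open>(1 + \<bar>x\<bar>\<^sup>2)' \<le> h (1 + \<bar>x\<bar>\<^sup>2)\<close> will give for
    \<open>1 + \<bar>x\<bar>\<^sup>2\<close>, and hence for \<open>\<bar>x\<bar>\<close>, once positivity is known.\<close>
  define h where "h t = 2 * (norm (b t) + norm (c t) + norm (d t))" for t
  have h: "continuous_on {t0..} h"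
    unfolding h_def by (intro continuous_intros cont)
  define R where "R t = (1 + (norm x0)\<^sup>2) * exp (integral {t0..t} h)" for t
  have R: "continuous_on {t0..} R"
    unfolding R_def by (intro continuous_intros continuous_on_integral_half_line h)
  have R_pos: "0 < R t" for t
    unfolding R_def by (intro mult_pos_pos add_pos_nonneg) auto
  let ?f = "\<lambda>t. riccati_field (a t) (b t) (c t) (d t)"
  obtain x where x_t0: "x t0 = x0" and x_trunc: "\<And>t. t0 \<le> t \<Longrightarrow>
      (x has_vector_derivative ?f t (radial_factor (R t) (x t) *\<^sub>R x t)) (at t within {t0..})"
    using truncated_riccati_solution[OF cont R R_pos, of x0] by blast
  have x: "continuous_on {t0..} x"
    using x_trunc by (intro continuous_on_vector_derivative) auto
  define r where "r t = radial_factor (R t) (x t)" for t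
  have r: "continuous_on {t0..} r"
    unfolding r_def by (intro continuous_on_radial_factor R x R_pos)
  have r_range: "0 \<le> r t" "r t \<le> 1" for t
    using radial_factor_pos[OF R_pos, of t "x t"] radial_factor_le_1[OF R_pos, of t "x t"]
    by (auto simp: r_def)
  have der: "(x has_vector_derivative ?f t (r t *\<^sub>R x t)) (at t within {t0..})" if "t0 \<le> t" for t
    using x_trunc[OF that] by (simp add: r_def)

  \<comment> \<open>Each component with index in \<open>S\<close> is bounded below by its initial value times an exponential;
    this gives weak and strict positivity together.\<close>
  have lower: "\<exists>e. signed_comp n (x t) \<ge> \<gamma> n * exp e" if n: "n \<in> S" and t: "t0 \<le> t" for n t
  proof -
    \<comment> \<open>The outer factor \<open>r t\<close> turns the component of the truncated point back into that of
      \<open>x t\<close>.\<close>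
    define g where "g t = (qcomp n (a t) * signed_comp n (r t *\<^sub>R x t) - 2 * qre (a t * (r t *\<^sub>R x t))
        - qre (b t) - qre (c t)) * r t" for t
    have n3: "n \<in> {0, 1, 2, 3}" using n S by auto
    interpret sc: bounded_linear "signed_comp n"
      by (rule bounded_linear_signed_comp)
    have "continuous_on {t0..} (\<lambda>t. qcomp n (a t))"
    proof -
      have "qcomp n = (\<lambda>q. if n = 0 then signed_comp n q else - signed_comp n q)"
        by (auto simp: signed_comp_def qcomp_def)
      then show ?thesis
        using sc.continuous_on[OF cont(1)] by (cases "n = 0") (auto intro: continuous_on_minus)
    qed
    then have "continuous_on {t0..} g"
      unfolding g_def
      by (intro continuous_intros sc.continuous_on bounded_linear.continuous_on[OF bounded_linear_qre]
          cont r x)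
    moreover have "((\<lambda>t. signed_comp n (x t)) has_vector_derivative
        signed_comp n (?f t (r t *\<^sub>R x t))) (at t within {t0..})" if "t0 \<le> t" for t
      using sc.has_vector_derivative[OF der[OF that]] .
    moreover have "g t * signed_comp n (x t) \<le> signed_comp n (?f t (r t *\<^sub>R x t))" if "t0 \<le> t" for t
      using riccati_field_quasi_positive[OF n3 a_nonneg[OF that n] p_zero[OF that n] D_nonpos[OF that n],
          of "r t *\<^sub>R x t"]
      by (simp add: g_def sc.scaleR mult.assoc)
    ultimately have "signed_comp n (x t0) * exp (integral {t0..t} g) \<le> signed_comp n (x t)"
      using t by (rule linear_differential_inequality)
    then show ?thesis
      by (auto simp: x_t0 x0[OF n3])
  qed
  have nonneg: "0 \<le> signed_comp n (x t)" if "n \<in> S" "t0 \<le> t" for n t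
    using lower[OF that] \<gamma>_nonneg[OF that(1)] by (meson exp_ge_zero mult_nonneg_nonneg order_trans)
  have pos: "0 < signed_comp n (x t)" if "n \<in> S" "t0 \<le> t" "0 < \<gamma> n" for n t
    using lower[OF that(1,2)] that(3) by (meson exp_gt_zero mult_pos_pos less_le_trans)

  have ax: "0 \<le> qre (a t * x t)" if "t0 \<le> t" for t
    unfolding qre_mult_eq_sum_signed_comps
  proof (rule sum_nonneg)
    fix n :: nat
    assume "n \<in> {0, 1, 2, 3}"
    then show "0 \<le> qcomp n (a t) * signed_comp n (x t)"
      using that S a_nonneg a_zero nonneg by (cases "n \<in> S") auto
  qed
  have bound: "norm (x t) \<le> R t" if "t0 \<le> t" for t
  proof -
    have "- (1 + (norm (x t0))\<^sup>2) * exp (integral {t0..t} h) \<le> - (1 + (norm (x t))\<^sup>2)"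
    proof (rule linear_differential_inequality[OF h _ _ that])
      fix t assume t: "t0 \<le> t"
      show "((\<lambda>t. - (1 + (norm (x t))\<^sup>2)) has_vector_derivative
          - 2 * inner (x t) (?f t (r t *\<^sub>R x t))) (at t within {t0..})"
        unfolding dot_square_norm[symmetric]
        using bounded_bilinear.has_vector_derivative[OF bounded_bilinear_inner der[OF t] der[OF t]]
        by (auto intro!: derivative_eq_intros simp: inner_commute)
      show "h t * - (1 + (norm (x t))\<^sup>2) \<le> - 2 * inner (x t) (?f t (r t *\<^sub>R x t))"
        using riccati_field_energy_bound[OF ax[OF t] r_range[of t], of "b t" "c t" "d t"]
        unfolding h_def by linarith
    qed
    then have "1 + (norm (x t))\<^sup>2 \<le> R t"
      by (simp only: R_def x_t0 mult_minus_left neg_le_iff_le)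
    then show ?thesis
      using sum_squares_bound[of 1 "norm (x t)"] norm_ge_zero[of "x t"] by (simp del: norm_ge_zero)
  qed
  \<comment> \<open>The solution stays where the truncation is the identity.\<close>
  have solves: "(x has_vector_derivative ?f t (x t)) (at t within {t0..})" if "t0 \<le> t" for t
    using der[OF that] radial_factor_eq_1[OF R_pos bound[OF that]] by (simp add: r_def)
  have "riccati_solution a b c d t0 x"
    unfolding riccati_solution_def
  proof (intro exI[of _ "\<lambda>t. ?f t (x t)"] conjI allI impI)
    show "continuous_on {t0..} (\<lambda>t. ?f t (x t))"
      by (intro continuous_on_riccati_field cont x)
  qed (use solves in \<open>auto simp: riccati_field_def\<close>)
  then show ?thesis
    using nonneg pos x0
    by (intro exI[of _ "\<lambda>n t. signed_comp n (x t)"])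
      (auto simp: quat_of_signed_comps[unfolded One_nat_def] x_t0)
qed

end
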